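(* For every election instance consisting of $k \ge 1$ offices with pairwise disjoint nonempty finite candidate sets $A_1,\dots,A_k$ and $n \ge 1$ voters with approval ballots $v_1,\dots,v_n \subseteq A = \bigcup_{j\in[k]} A_j$, there exists an office allocation $X$ satisfying Global Justified Representation, and such an office allocation can be computed in time polynomial in the size of the instance.
   Context: Setting. $[k]=\{1,\dots,k\}$. There are $k$ offices; office $j$ has a nonempty finite set $A_j$ of candidates, the sets $A_1,\dots,A_k$ are pairwise disjoint, and $A=\bigcup_{j\in[k]}A_j$. There are $n$ voters $V=\{v_1,\dots,v_n\}$; each voter $v$ is identified with her approval ballot $v\subseteq A$ (different voters may have identical ballots and are still counted separately, so $|V|=n$). An office allocation is a set $X=\{w_1,\dots,w_k\}$ with $w_j\in A_j$ for every $j\in[k]$. Definition (Global Justified Representation). An office allocation $X$ satisfies Global Justified Representation if for every group of voters $V'\subseteq V$ with $|V'|\ge n/k$ the following holds: if $\left(\bigcap_{v\in V'}v\right)\cap A_j\neq\emptyset$ for all $j\in[k]$, then $X\cap\left(\bigcup_{v\in V'}v\right)\neq\emptyset$. *)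

theory Defs
  imports "HOL-Library.Disjoint_Sets" "HOL-Computational_Algebra.Polynomial"
begin

section \<open>Elections, office allocations, Global Justified Representation\<close>

text \<open>
  Voters are the indices \<open>1, \<dots>, n\<close> and \<open>v i\<close> is the ballot of voter \<open>i\<close>, so voters with
  identical ballots are counted separately.
\<close>

definition election :: "nat \<Rightarrow> (nat \<Rightarrow> 'a set) \<Rightarrow> nat \<Rightarrow> (nat \<Rightarrow> 'a set) \<Rightarrow> bool" where
  "election k A n v \<longleftrightarrow>
     k \<ge> 1 \<and> n \<ge> 1 \<and>
     (\<forall>j\<in>{1..k}. finite (A j) \<and> A j \<noteq> {}) \<and>
     disjoint_family_on A {1..k} \<and>
     (\<forall>i\<in>{1..n}. v i \<subseteq> (\<Union>j\<in>{1..k}. A j))"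

definition office_allocation :: "nat \<Rightarrow> (nat \<Rightarrow> 'a set) \<Rightarrow> 'a set \<Rightarrow> bool" where
  "office_allocation k A X \<longleftrightarrow> (\<exists>w. (\<forall>j\<in>{1..k}. w j \<in> A j) \<and> X = w ` {1..k})"

definition global_JR ::
  "nat \<Rightarrow> (nat \<Rightarrow> 'a set) \<Rightarrow> nat \<Rightarrow> (nat \<Rightarrow> 'a set) \<Rightarrow> 'a set \<Rightarrow> bool" where
  "global_JR k A n v X \<longleftrightarrow>
     (\<forall>V'\<subseteq>{1..n}. real (card V') \<ge> real n / real k \<longrightarrow>
        (\<forall>j\<in>{1..k}. (\<Inter>i\<in>V'. v i) \<inter> A j \<noteq> {}) \<longrightarrow>
        X \<inter> (\<Union>i\<in>V'. v i) \<noteq> {})"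


section \<open>Polynomial time\<close>

text \<open>
  The machine model is the WHILE language over binary trees of N. D. Jones (Computability and
  Complexity from a Programming Perspective, MIT Press 1997), with three-address commands: a
  program has finitely many registers holding trees, and it can only build, inspect and take
  apart one node per step.  Every command costs one time unit, which is its cost up to a constant
  factor on a machine that represents trees by pointers.  For problems whose answers have size
  polynomial in the input, polynomial time in this model coincides with polynomial time on Turing
  machines.  There is no unit-cost arithmetic and no unit-cost
  equality test.
\<close>

datatype tree = Leaf | Node tree tree

fun left :: "tree \<Rightarrow> tree" where
  "left Leaf = Leaf"
| "left (Node a b) = a"

fun right :: "tree \<Rightarrow> tree" where
  "right Leaf = Leaf"
| "right (Node a b) = b"

type_synonym reg = nat
type_synonym store = "reg \<Rightarrow> tree"

datatype com =
    Skip
  | SetLeaf reg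
  | Copy reg reg
  | SetNode reg reg reg
  | SetLeft reg reg
  | SetRight reg reg
  | Seq com com
  | If reg com com
  | While reg com

text \<open>\<open>exec c s t s'\<close>: started in store \<open>s\<close>, program \<open>c\<close> halts in store \<open>s'\<close> after \<open>t\<close> steps.\<close>

inductive exec :: "com \<Rightarrow> store \<Rightarrow> nat \<Rightarrow> store \<Rightarrow> bool" where
  Skip: "exec Skip s 1 s"
| SetLeaf: "exec (SetLeaf x) s 1 (s(x := Leaf))"
| Copy: "exec (Copy x y) s 1 (s(x := s y))"
| SetNode: "exec (SetNode x y z) s 1 (s(x := Node (s y) (s z)))"
| SetLeft: "exec (SetLeft x y) s 1 (s(x := left (s y)))"
| SetRight: "exec (SetRight x y) s 1 (s(x := right (s y)))"
| Seq: "exec c s t s' \<Longrightarrow> exec d s' t' s'' \<Longrightarrow> exec (Seq c d) s (t + t') s''"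
| IfNode: "s x \<noteq> Leaf \<Longrightarrow> exec c s t s' \<Longrightarrow> exec (If x c d) s (1 + t) s'"
| IfLeaf: "s x = Leaf \<Longrightarrow> exec d s t s' \<Longrightarrow> exec (If x c d) s (1 + t) s'"
| WhileLeaf: "s x = Leaf \<Longrightarrow> exec (While x c) s 1 s"
| WhileNode: "s x \<noteq> Leaf \<Longrightarrow> exec c s t s' \<Longrightarrow> exec (While x c) s' t' s'' \<Longrightarrow>
    exec (While x c) s (1 + t + t') s''"

inductive_cases exec_SkipE: "exec Skip s t s'"
inductive_cases exec_SetLeafE: "exec (SetLeaf x) s t s'"
inductive_cases exec_CopyE: "exec (Copy x y) s t s'"
inductive_cases exec_SetNodeE: "exec (SetNode x y z) s t s'"
inductive_cases exec_SetLeftE: "exec (SetLeft x y) s t s'"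
inductive_cases exec_SetRightE: "exec (SetRight x y) s t s'"
inductive_cases exec_SeqE: "exec (Seq c d) s t s'"
inductive_cases exec_IfE: "exec (If x c d) s t s'"
inductive_cases exec_WhileE: "exec (While x c) s t s'"

lemma exec_deterministic:
  "exec c s t s' \<Longrightarrow> exec c s u s'' \<Longrightarrow> u = t \<and> s'' = s'"
proof (induction arbitrary: u s'' rule: exec.induct)
  case (Seq c s t s' d t' s2)
  from Seq.prems show ?case by (rule exec_SeqE) (metis Seq.IH)
next
  case (IfNode s x c t s' d)
  from IfNode.prems show ?case by (rule exec_IfE) (metis IfNode.IH plus_1_eq_Suc, metis IfNode.hyps(1))
next
  case (IfLeaf s x d t s' c)
  from IfLeaf.prems show ?case by (rule exec_IfE) (metis IfLeaf.hyps(1), metis IfLeaf.IH plus_1_eq_Suc)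
next
  case (WhileLeaf s x c)
  from WhileLeaf.prems show ?case by (rule exec_WhileE) (simp, metis WhileLeaf.hyps)
next
  case (WhileNode s x c t s' t' s2)
  from WhileNode.prems show ?case
    by (rule exec_WhileE) (metis WhileNode.hyps(1), metis WhileNode.IH plus_1_eq_Suc add_Suc)
qed (erule exec_SkipE exec_SetLeafE exec_CopyE exec_SetNodeE exec_SetLeftE exec_SetRightE, simp)+

definition initial :: "tree \<Rightarrow> store" where
  "initial a = (\<lambda>_. Leaf)(0 := a)"

text \<open>
  A search problem with instances \<open>I\<close>, encoding \<open>ein\<close> of instances, encoding \<open>eout\<close> of answers,
  and relation \<open>R\<close> between instances and acceptable answers is solvable in polynomial time if one
  program halts on every encoded instance within a number of steps polynomial in the size (number
  of inner nodes) of the encoding, leaving the encoding of an acceptable answer in register 0.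
\<close>

definition poly_time_solvable ::
  "'i set \<Rightarrow> ('i \<Rightarrow> tree) \<Rightarrow> ('o \<Rightarrow> tree) \<Rightarrow> ('i \<Rightarrow> 'o \<Rightarrow> bool) \<Rightarrow> bool" where
  "poly_time_solvable I ein eout R \<longleftrightarrow>
     (\<exists>c (p :: nat poly). \<forall>x\<in>I. \<exists>t s y.
        exec c (initial (ein x)) t s \<and> t \<le> poly p (size (ein x)) \<and> s 0 = eout y \<and> R x y)"


section \<open>Elections as inputs\<close>

text \<open>
  As input to a program, an election has bit strings as names of the candidates.  It is given by
  the list of offices and the list of voters; an office is a list of its candidates, a ballot is a
  list of the approved candidates, in any order and without repetitions.
\<close>

type_synonym candidate = "bool list"
type_synonym instance_data = "candidate list list \<times> candidate list list"

fun enc_bool :: "bool \<Rightarrow> tree" where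
  "enc_bool False = Leaf"
| "enc_bool True = Node Leaf Leaf"

fun enc_list :: "('b \<Rightarrow> tree) \<Rightarrow> 'b list \<Rightarrow> tree" where
  "enc_list e [] = Leaf"
| "enc_list e (x # xs) = Node (e x) (enc_list e xs)"

definition enc_candidates :: "candidate list \<Rightarrow> tree" where
  "enc_candidates = enc_list (enc_list enc_bool)"

definition enc_instance :: "instance_data \<Rightarrow> tree" where
  "enc_instance = (\<lambda>(As, vs). Node (enc_list enc_candidates As) (enc_list enc_candidates vs))"

lemma inj_enc_list:
  assumes "inj e"
  shows "inj (enc_list e)"
proof (rule injI)
  fix xs ys
  show "enc_list e xs = enc_list e ys \<Longrightarrow> xs = ys"
  proof (induction xs arbitrary: ys)
    case Nil
    then show ?case by (cases ys) auto
  next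
    case (Cons x xs)
    then show ?case using assms by (cases ys) (auto dest: injD)
  qed
qed

lemma inj_enc_bool: "inj enc_bool"
proof (rule injI)
  fix x y show "enc_bool x = enc_bool y \<Longrightarrow> x = y" by (cases x; cases y) simp_all
qed

lemma inj_enc_candidates: "inj enc_candidates"
  unfolding enc_candidates_def by (intro inj_enc_list inj_enc_bool)

lemma inj_enc_instance: "inj enc_instance"
  using inj_enc_list[OF inj_enc_candidates]
  by (auto simp: inj_def enc_instance_def)

text \<open>List positions start at 0, whereas offices and voters are numbered from 1.\<close>

definition nth_set :: "'a list list \<Rightarrow> nat \<Rightarrow> 'a set" where
  "nth_set xss j = set (xss ! (j - 1))"

definition instances :: "instance_data set" where
  "instances = {(As, vs).
     election (length As) (nth_set As) (length vs) (nth_set vs) \<and>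
     (\<forall>xs \<in> set As \<union> set vs. distinct xs)}"

definition global_JR_answer :: "instance_data \<Rightarrow> candidate list \<Rightarrow> bool" where
  "global_JR_answer = (\<lambda>(As, vs) ws.
     distinct ws \<and>
     office_allocation (length As) (nth_set As) (set ws) \<and>
     global_JR (length As) (nth_set As) (length vs) (nth_set vs) (set ws))"

end

theory Submission
  imports Defs
begin

text \<open>
  Fill the offices one after the other, each time with a candidate that leaves as few voters as
  possible without an approved winner.  If a group \<open>V'\<close> violates the condition, then it is
  unrepresented throughout and could agree on a candidate for every office, so each of the \<open>k\<close>
  choices newly represents at least \<open>card V'\<close> voters.  Together with \<open>V'\<close> itself these are at least
  \<open>(k + 1) * card V' > n\<close> voters.
\<close>

section \<open>The greedy allocation\<close>

definition unrepresented :: "nat \<Rightarrow> (nat \<Rightarrow> 'a set) \<Rightarrow> 'a set \<Rightarrow> nat set" where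
  "unrepresented n v X = {i \<in> {1..n}. v i \<inter> X = {}}"

text \<open>The requirement at \<open>j\<close> looks only at the values of \<open>w\<close> up to
  \<open>j\<close>, so choices already made stay valid when later values of \<open>w\<close>
  change.\<close>

definition greedy_choice ::
  "(nat \<Rightarrow> 'a set) \<Rightarrow> nat \<Rightarrow> (nat \<Rightarrow> 'a set) \<Rightarrow> (nat \<Rightarrow> 'a) \<Rightarrow> nat \<Rightarrow> bool" where
  "greedy_choice A n v w j \<longleftrightarrow> w j \<in> A j \<and>
     (\<forall>c\<in>A j. card (unrepresented n v (w ` {1..j}))
        \<le> card (unrepresented n v (insert c (w ` {1..<j}))))"

lemma finite_unrepresented [simp]: "finite (unrepresented n v X)"
  by (simp add: unrepresented_def)

lemma greedy_choice_global_JR: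
  assumes "k \<ge> 1" "n \<ge> 1" and greedy: "\<And>j. j \<in> {1..k} \<Longrightarrow> greedy_choice A n v w j"
  shows "global_JR k A n v (w ` {1..k})"
  unfolding global_JR_def
proof (intro allI impI notI)
  fix V'
  assume V': "V' \<subseteq> {1..n}" and large: "real n / real k \<le> real (card V')"
    and common: "\<forall>j\<in>{1..k}. (\<Inter>i\<in>V'. v i) \<inter> A j \<noteq> {}"
    and none: "w ` {1..k} \<inter> (\<Union>i\<in>V'. v i) = {}"
  let ?U = "\<lambda>j. unrepresented n v (w ` {1..j})"
  have fin: "finite V'"
    using V' finite_subset by blast
  have sub: "V' \<subseteq> ?U j" if "j \<le> k" for j
  proof -
    have "w ` {1..j} \<subseteq> w ` {1..k}"
      using that by (intro image_mono) auto
    with V' none show ?thesis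
      unfolding unrepresented_def by blast
  qed
  \<comment> \<open>Each filled office lowers the number of unrepresented voters by at least
    \<open>card V'\<close>.\<close>
  have "card (?U j) + j * card V' \<le> n" if "j \<le> k" for j
    using that
  proof (induction j)
    case 0
    have "?U 0 = {1..n}"
      by (auto simp: unrepresented_def)
    then show ?case
      by simp
  next
    case (Suc j)
    then obtain c where c: "c \<in> A (Suc j)" "\<And>i. i \<in> V' \<Longrightarrow> c \<in> v i"
    proof -
      have "(\<Inter>i\<in>V'. v i) \<inter> A (Suc j) \<noteq> {}"
        using common Suc.prems by simp
      then show ?thesis
        using that by blast
    qed
    have "{1..<Suc j} = {1..j}"
      by auto
    then have "card (?U (Suc j)) \<le> card (unrepresented n v (insert c (w ` {1..j})))"
      using greedy[of "Suc j"] c(1) Suc.prems by (auto simp: greedy_choice_def)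
    \<comment> \<open>Every member of \<open>V'\<close> is unrepresented before this choice and
      approves \<open>c\<close>.\<close>
    also have "\<dots> \<le> card (?U j - V')"
      using c(2) by (intro card_mono) (auto simp: unrepresented_def)
    also have "\<dots> = card (?U j) - card V'"
      using sub[of j] Suc.prems fin by (intro card_Diff_subset) auto
    finally have "card (?U (Suc j)) + card V' \<le> card (?U j)"
      using card_mono[OF _ sub[of j]] Suc.prems by simp
    then show ?case
      using Suc by simp
  qed
  \<comment> \<open>The group itself is still unrepresented at the end, which contributes one
    further \<open>card V'\<close>. Together with \<open>n \<le> k * card V'\<close> this leaves
    only an empty group, and then \<open>n = 0\<close>.\<close>
  from this[of k] have "card V' + k * card V' \<le> n"
    using card_mono[OF _ sub[of k]] by simp
  moreover have "n \<le> k * card V'"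
  proof -
    have "real n \<le> real (card V') * real k"
      using large \<open>k \<ge> 1\<close> by (simp add: pos_divide_le_eq)
    then show ?thesis
      by (metis mult.commute of_nat_le_iff of_nat_mult)
  qed
  ultimately have "card V' = 0"
    by linarith
  with \<open>n \<le> k * card V'\<close> \<open>n \<ge> 1\<close> show False
    by simp
qed

text \<open>The single extension step shared by the existence proof and the loop invariant of the
  program.\<close>

lemma greedy_choice_extend:
  assumes w: "\<forall>j\<in>{1..k}. greedy_choice A n v w j" and c: "c \<in> A (Suc k)"
    and least: "\<And>c'. c' \<in> A (Suc k) \<Longrightarrow>
      card (unrepresented n v (insert c (w ` {1..k})))
        \<le> card (unrepresented n v (insert c' (w ` {1..k})))"
  shows "\<forall>j\<in>{1..Suc k}. greedy_choice A n v (w(Suc k := c)) j"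
proof
  fix j
  assume j: "j \<in> {1..Suc k}"
  let ?w = "w(Suc k := c)"
  show "greedy_choice A n v ?w j"
  proof (cases "j = Suc k")
    case True
    have less: "?w ` {1..<Suc k} = w ` {1..k}"
      by (rule image_cong) auto
    have "{1..Suc k} = insert (Suc k) {1..<Suc k}"
      by auto
    then have "?w ` {1..Suc k} = insert c (w ` {1..k})"
      by (metis less image_insert fun_upd_same)
    with less show ?thesis
      unfolding greedy_choice_def True using c least by simp
  next
    case False
    moreover from this have "?w ` {1..j} = w ` {1..j}" "?w ` {1..<j} = w ` {1..<j}"
      using j by (intro image_cong; auto)+
    ultimately show ?thesis
      using w j by (auto simp: greedy_choice_def)
  qed
qed

lemma greedy_choice_exists:
  assumes "\<And>j. j \<in> {1..k} \<Longrightarrow> A j \<noteq> {}"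
  shows "\<exists>w. \<forall>j\<in>{1..k}. greedy_choice A n v w j"
  using assms
proof (induction k)
  case 0
  then show ?case
    by simp
next
  case (Suc k)
  then obtain w where w: "\<forall>j\<in>{1..k}. greedy_choice A n v w j"
    by fastforce
  let ?f = "\<lambda>c. card (unrepresented n v (insert c (w ` {1..k})))"
  obtain c where "c \<in> A (Suc k)" "\<And>c'. c' \<in> A (Suc k) \<Longrightarrow> ?f c \<le> ?f c'"
    using ex_has_least_nat[of "\<lambda>c. c \<in> A (Suc k)" _ ?f] Suc.prems[of "Suc k"] by auto
  with greedy_choice_extend[OF w] show ?case
    by blast
qed

section \<open>Weakest preconditions with running time\<close>

text \<open>Total correctness: a halting run must exist, and by determinism it is the only one. The
  postcondition also sees the number of steps, so time bounds and functional correctness are proved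
  together.\<close>

definition wp :: "com \<Rightarrow> (nat \<Rightarrow> store \<Rightarrow> bool) \<Rightarrow> store \<Rightarrow> bool" where
  "wp c Q s \<longleftrightarrow> (\<exists>t s'. exec c s t s' \<and> Q t s')"

lemma wp_Skip [simp]: "wp Skip Q s \<longleftrightarrow> Q 1 s"
  unfolding wp_def by (metis exec.Skip exec_deterministic)

lemma wp_SetLeaf [simp]: "wp (SetLeaf x) Q s \<longleftrightarrow> Q 1 (s(x := Leaf))"
  unfolding wp_def by (metis exec.SetLeaf exec_deterministic)

lemma wp_Copy [simp]: "wp (Copy x y) Q s \<longleftrightarrow> Q 1 (s(x := s y))"
  unfolding wp_def by (metis exec.Copy exec_deterministic)

lemma wp_SetNode [simp]: "wp (SetNode x y z) Q s \<longleftrightarrow> Q 1 (s(x := Node (s y) (s z)))"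
  unfolding wp_def by (metis exec.SetNode exec_deterministic)

lemma wp_SetLeft [simp]: "wp (SetLeft x y) Q s \<longleftrightarrow> Q 1 (s(x := left (s y)))"
  unfolding wp_def by (metis exec.SetLeft exec_deterministic)

lemma wp_SetRight [simp]: "wp (SetRight x y) Q s \<longleftrightarrow> Q 1 (s(x := right (s y)))"
  unfolding wp_def by (metis exec.SetRight exec_deterministic)

lemma wp_Seq [simp]: "wp (Seq c d) Q s \<longleftrightarrow> wp c (\<lambda>t. wp d (\<lambda>t'. Q (t + t'))) s"
proof
  show "wp (Seq c d) Q s \<Longrightarrow> wp c (\<lambda>t. wp d (\<lambda>t'. Q (t + t'))) s"
    unfolding wp_def by (auto elim!: exec_SeqE)
  show "wp c (\<lambda>t. wp d (\<lambda>t'. Q (t + t'))) s \<Longrightarrow> wp (Seq c d) Q s"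
    unfolding wp_def using exec.Seq by meson
qed

lemma wp_If [simp]:
  "wp (If x c d) Q s \<longleftrightarrow>
    (if s x \<noteq> Leaf then wp c (\<lambda>t. Q (1 + t)) s else wp d (\<lambda>t. Q (1 + t)) s)"
  by (auto simp: wp_def elim!: exec_IfE) (metis exec.IfNode exec.IfLeaf plus_1_eq_Suc)+

lemma wp_mono: "wp c P s \<Longrightarrow> (\<And>t s'. P t s' \<Longrightarrow> Q t s') \<Longrightarrow> wp c Q s"
  by (auto simp: wp_def)

text \<open>The invariant carries a ghost list of the items still to be processed, empty exactly
  when the guard register holds \<open>Leaf\<close>. Induction on it gives termination and the time:
  each item costs one guard test and at most \<open>T\<close> steps, and the final failing test
  costs one more.\<close>

lemma wp_While:
  assumes "Inv xs s"
    and guard: "\<And>ys s. Inv ys s \<Longrightarrow> s x = Leaf \<longleftrightarrow> ys = []"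
    and body: "\<And>y ys s. Inv (y # ys) s \<Longrightarrow> wp c (\<lambda>t s'. t \<le> T \<and> Inv ys s') s"
  shows "wp (While x c) (\<lambda>t s'. t \<le> 1 + length xs * (T + 1) \<and> Inv [] s') s"
  using assms(1)
proof (induction xs arbitrary: s)
  case Nil
  then show ?case
    using guard[OF Nil] by (auto simp: wp_def intro!: exI exec.WhileLeaf)
next
  case (Cons y ys)
  obtain t s' where 1: "exec c s t s'" "t \<le> T" "Inv ys s'"
    using body[OF Cons.prems] by (auto simp: wp_def)
  obtain t' s'' where 2: "exec (While x c) s' t' s''" "t' \<le> 1 + length ys * (T + 1)" "Inv [] s''"
    using Cons.IH[OF 1(3)] by (auto simp: wp_def)
  have "exec (While x c) s (1 + t + t') s''"
    using guard[OF Cons.prems] 1(1) 2(1) by (intro exec.WhileNode) auto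
  then show ?case
    using 1(2) 2(2,3) by (auto simp: wp_def intro!: exI)
qed

section \<open>Frame rule for registers that a program does not write\<close>

fun writes :: "com \<Rightarrow> reg set" where
  "writes Skip = {}"
| "writes (SetLeaf x) = {x}"
| "writes (Copy x y) = {x}"
| "writes (SetNode x y z) = {x}"
| "writes (SetLeft x y) = {x}"
| "writes (SetRight x y) = {x}"
| "writes (Seq c d) = writes c \<union> writes d"
| "writes (If x c d) = writes c \<union> writes d"
| "writes (While x c) = writes c"

lemma exec_not_writes: "exec c s t s' \<Longrightarrow> r \<notin> writes c \<Longrightarrow> s' r = s r"
  by (induction rule: exec.induct) auto

text \<open>The specification of a subprogram mentions only its results; the caller recovers from
  \<open>writes\<close> that its own registers are intact.\<close>

lemma wp_call:
  assumes "wp c P s"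
    and "\<And>t s'. P t s' \<Longrightarrow> (\<And>r. r \<notin> writes c \<Longrightarrow> s' r = s r) \<Longrightarrow> Q t s'"
  shows "wp c Q s"
  using assms exec_not_writes unfolding wp_def by blast

section \<open>The greedy program\<close>

lemma enc_list_eq_Leaf [simp]: "enc_list e xs = Leaf \<longleftrightarrow> xs = []"
  by (cases xs) auto

lemma Leaf_eq_enc_list [simp]: "Leaf = enc_list e xs \<longleftrightarrow> xs = []"
  by (cases xs) auto

lemma enc_bool_eq_Leaf [simp]: "enc_bool b = Leaf \<longleftrightarrow> \<not> b"
  by (cases b) auto

abbreviation enc_cand :: "candidate \<Rightarrow> tree" where
  "enc_cand \<equiv> enc_list enc_bool"

section \<open>Comparing bit strings, membership in a ballot, filtering ballots\<close>

text \<open>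
  Registers: 0 input and output, 1 remaining offices, 2 unrepresented ballots, 3 winners so far,
  4 remaining candidates of the current office, 5 candidate under test, 6 ballots still to be
  filtered, 7 current ballot, 8 ballots left unrepresented by 5, 9 the shortest such list so far,
  10 its candidate, 11 result of \<open>5 \<in> 7\<close>, 12 rest of the ballot 7, 14 result of \<open>15 = 16\<close>,
  19 result of \<open>length 9 > length 8\<close>; 15--18, 20, 21 scratch.
\<close>

definition eq_prog :: com where
  "eq_prog = Seq (SetNode 14 14 14) (Seq
     (While 15 (Seq (SetLeft 17 15) (Seq (SetRight 15 15)
       (If 16 (Seq (SetLeft 18 16) (Seq (SetRight 16 16)
          (If 17 (If 18 Skip (SetLeaf 14)) (If 18 (SetLeaf 14) Skip))))
        (SetLeaf 14)))))
     (If 16 (SetLeaf 14) Skip))"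

lemma writes_eq_prog [simp]: "writes eq_prog = {14, 15, 16, 17, 18}"
  by (auto simp: eq_prog_def)

text \<open>Register 14 starts as a node and is cleared at every discrepancy. The loop always
  consumes all of \<open>a\<close>, which bounds the time; the last test catches a second string
  that is longer.\<close>

lemma wp_eq_prog:
  assumes s: "s 15 = enc_cand a" "s 16 = enc_cand b" and N: "length a \<le> N"
  shows "wp eq_prog (\<lambda>t s'. t \<le> 10 * N + 4 \<and> (s' 14 \<noteq> Leaf \<longleftrightarrow> a = b)) s"
proof -
  \<comment> \<open>While register 14 is set, equality of the remainders decides
    \<open>a = b\<close>; once it is cleared, the remainders are arbitrary.\<close>
  define Inv where "Inv = (\<lambda>xs (s :: store). \<exists>ys. s 15 = enc_cand xs \<and> s 16 = enc_cand ys \<and>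
    (a = b \<longleftrightarrow> s 14 \<noteq> Leaf \<and> xs = ys))"
  show ?thesis
    unfolding eq_prog_def wp_Seq wp_SetNode
  proof (rule wp_mono[OF wp_While[where Inv = Inv and xs = a and T = 9]], goal_cases)
    case 1
    then show ?case
      using s by (auto simp: Inv_def)
  next
    case (2 ys s)
    then show ?case
      by (auto simp: Inv_def)
  next
    case (3 x xs s)
    then obtain ys where ys: "s 15 = enc_cand (x # xs)" "s 16 = enc_cand ys"
      "a = b \<longleftrightarrow> s 14 \<noteq> Leaf \<and> x # xs = ys"
      by (auto simp: Inv_def)
    show ?case
      using ys by (cases ys) (auto simp: Inv_def intro: exI[of _ "[]"])
  next
    case (4 t s')
    then show ?case
      using N by (auto simp: Inv_def)
  qed
qed

text \<open>The loop takes its list apart and \<open>eq_prog\<close> destroys its arguments, so both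
  work on copies; registers 5 and 7 are read again later.\<close>

definition mem_prog :: com where
  "mem_prog = Seq (SetLeaf 11) (Seq (Copy 12 7)
     (While 12 (Seq (SetLeft 15 12) (Seq (SetRight 12 12) (Seq (Copy 16 5) (Seq eq_prog
        (If 14 (SetNode 11 14 14) Skip)))))))"

lemma writes_mem_prog [simp]: "writes mem_prog = {11, 12, 14, 15, 16, 17, 18}"
  by (auto simp: mem_prog_def)

lemma wp_mem_prog:
  assumes s: "s 5 = enc_cand c" "s 7 = enc_candidates v"
    and N: "length v \<le> N" "\<And>x. x \<in> set v \<Longrightarrow> length x \<le> N"
  shows "wp mem_prog (\<lambda>t s'. t \<le> 3 + N * (10 * N + 10) \<and> (s' 11 \<noteq> Leaf \<longleftrightarrow> c \<in> set v)) s"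
proof -
  define Inv where "Inv = (\<lambda>xs (s :: store). s 5 = enc_cand c \<and> s 12 = enc_candidates xs \<and>
    set xs \<subseteq> set v \<and> (c \<in> set v \<longleftrightarrow> s 11 \<noteq> Leaf \<or> c \<in> set xs))"
  show ?thesis
    unfolding mem_prog_def wp_Seq[of "SetLeaf _"] wp_Seq[of "Copy 12 _"] wp_SetLeaf wp_Copy
  proof (rule wp_mono[OF wp_While[where Inv = Inv and xs = v and T = "10 * N + 9"]], goal_cases)
    case 1
    then show ?case
      using s by (auto simp: Inv_def)
  next
    case (2 ys s)
    then show ?case
      by (auto simp: Inv_def enc_candidates_def)
  next
    case (3 x xs s)
    then have s: "s 5 = enc_cand c" "s 12 = Node (enc_cand x) (enc_candidates xs)"
      "set (x # xs) \<subseteq> set v" "c \<in> set v \<longleftrightarrow> s 11 \<noteq> Leaf \<or> c \<in> set (x # xs)"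
      by (auto simp: Inv_def enc_candidates_def)
    show ?case
      unfolding wp_Seq wp_SetLeft wp_SetRight wp_Copy
      by (rule wp_call[OF wp_eq_prog[of _ x c N]]) (use s N in \<open>auto simp: Inv_def\<close>)
  next
    case (4 t s')
    moreover from this have "t \<le> 1 + N * (10 * N + 10)"
      using mult_le_mono1[OF N(1), of "10 * N + 10"] by (simp add: algebra_simps)
    ultimately show ?case
      by (auto simp: Inv_def)
  qed
qed

definition filter_prog :: com where
  "filter_prog = Seq (SetLeaf 8) (Seq (Copy 6 2)
     (While 6 (Seq (SetLeft 7 6) (Seq (SetRight 6 6) (Seq mem_prog
        (If 11 Skip (SetNode 8 7 8)))))))"

lemma writes_filter_prog [simp]: "writes filter_prog = {6, 7, 8, 11, 12, 14, 15, 16, 17, 18}"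
  by (auto simp: filter_prog_def)

text \<open>Surviving ballots are pushed onto register 8, hence \<open>rev\<close>. The reversal is
  harmless, since only the multiset of ballots matters later.\<close>

lemma wp_filter_prog:
  assumes s: "s 5 = enc_cand c" "s 2 = enc_list enc_candidates R"
    and N: "length R \<le> N" "\<And>v. v \<in> set R \<Longrightarrow> length v \<le> N"
      "\<And>v x. v \<in> set R \<Longrightarrow> x \<in> set v \<Longrightarrow> length x \<le> N"
  shows "wp filter_prog (\<lambda>t s'. t \<le> 3 + N * (N * (10 * N + 10) + 8) \<and>
    s' 8 = enc_list enc_candidates (rev (filter (\<lambda>v. c \<notin> set v) R))) s"
proof -
  define Inv where "Inv = (\<lambda>xs (s :: store). \<exists>ys. s 5 = enc_cand c \<and>
    s 6 = enc_list enc_candidates xs \<and> set xs \<subseteq> set R \<and> s 8 = enc_list enc_candidates ys \<and>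
    rev (filter (\<lambda>v. c \<notin> set v) R) = rev (filter (\<lambda>v. c \<notin> set v) xs) @ ys)"
  show ?thesis
    unfolding filter_prog_def wp_Seq[of "SetLeaf _"] wp_Seq[of "Copy _ _"] wp_SetLeaf wp_Copy
  proof (rule wp_mono[OF wp_While[where Inv = Inv and xs = R and T = "N * (10 * N + 10) + 7"]],
      goal_cases)
    case 1
    then show ?case
      using s by (auto simp: Inv_def intro: exI[of _ "[]"])
  next
    case (2 ys s)
    then show ?case
      by (auto simp: Inv_def)
  next
    case (3 x xs s)
    then obtain ys where s: "s 5 = enc_cand c"
      "s 6 = Node (enc_candidates x) (enc_list enc_candidates xs)"
      "x \<in> set R" "set xs \<subseteq> set R" "s 8 = enc_list enc_candidates ys"
      "rev (filter (\<lambda>v. c \<notin> set v) R) = rev (filter (\<lambda>v. c \<notin> set v) (x # xs)) @ ys"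
      by (auto simp: Inv_def)
    show ?case
      unfolding wp_Seq wp_SetLeft wp_SetRight
    proof (rule wp_call[OF wp_mem_prog[of _ c x N]], goal_cases)
      case (5 t s')
      then show ?case
        using s by (cases "c \<in> set x") (auto simp: Inv_def intro: exI[of _ ys] exI[of _ "x # ys"])
    qed (use s N in auto)
  next
    case (4 t s')
    moreover from this have "t \<le> 1 + N * (N * (10 * N + 10) + 8)"
      using mult_le_mono1[OF N(1), of "N * (10 * N + 10) + 8"] by (simp add: algebra_simps)
    ultimately show ?case
      by (auto simp: Inv_def)
  qed
qed

section \<open>Choosing a candidate that leaves the fewest ballots unrepresented\<close>

definition longer_prog :: com where
  "longer_prog = Seq (SetLeaf 19) (Seq (Copy 20 9) (Seq (Copy 21 8)
     (While 20 (Seq (SetRight 20 20) (If 21 (SetRight 21 21) (SetNode 19 20 20))))))"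

lemma writes_longer_prog [simp]: "writes longer_prog = {19, 20, 21}"
  by (auto simp: longer_prog_def)

text \<open>Without arithmetic, lengths are compared by shortening both lists in parallel; register
  19 is set if \<open>ys\<close> runs out first. Only \<open>xs\<close> drives the loop, so its
  length alone bounds the time, and \<open>N + 1\<close> leaves room for the dummy entry placed by
  \<open>choose_prog\<close>.\<close>

lemma wp_longer_prog:
  assumes s: "s 9 = enc_list e xs" "s 8 = enc_list e ys" and N: "length xs \<le> N + 1"
  shows "wp longer_prog (\<lambda>t s'. t \<le> 4 * N + 8 \<and> (s' 19 \<noteq> Leaf \<longleftrightarrow> length xs > length ys)) s"
proof -
  define Inv where "Inv = (\<lambda>xs' (s :: store). \<exists>ys'. s 20 = enc_list e xs' \<and>
    s 21 = enc_list e ys' \<and>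
    (length xs > length ys \<longleftrightarrow> s 19 \<noteq> Leaf \<or> length xs' > length ys'))"
  show ?thesis
    unfolding longer_prog_def wp_Seq[of "SetLeaf _"] wp_Seq[of "Copy _ _"] wp_SetLeaf wp_Copy
  proof (rule wp_mono[OF wp_While[where Inv = Inv and xs = xs and T = 3]], goal_cases)
    case 1
    then show ?case
      using s by (auto simp: Inv_def)
  next
    case (2 ys s)
    then show ?case
      by (auto simp: Inv_def)
  next
    case (3 x xs' s)
    then obtain ys' where ys': "s 20 = enc_list e (x # xs')" "s 21 = enc_list e ys'"
      "length xs > length ys \<longleftrightarrow> s 19 \<noteq> Leaf \<or> length (x # xs') > length ys'"
      unfolding Inv_def by blast
    then show ?case
      by (cases ys') (auto simp: Inv_def intro: exI[of _ "tl ys'"])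
  next
    case (4 t s')
    then show ?case
      using N by (auto simp: Inv_def)
  qed
qed

text \<open>Register 9 keeps the ballots themselves rather than their number, so the best list can
  serve as the next list of unrepresented ballots. It is replaced only on strict
  improvement.\<close>

definition choose_prog :: com where
  "choose_prog = Seq (SetLeaf 9) (Seq (SetNode 9 9 2)
     (While 4 (Seq (SetLeft 5 4) (Seq (SetRight 4 4) (Seq filter_prog (Seq longer_prog
        (If 19 (Seq (Copy 9 8) (Copy 10 5)) Skip)))))))"

text \<open>The inner factor covers one run of \<open>filter_prog\<close>, one of
  \<open>longer_prog\<close> and the constant overhead per candidate; the whole is a polynomial of
  degree four.\<close>

definition choose_time :: "nat \<Rightarrow> nat" where
  "choose_time N = 3 + N * (N * (N * (10 * N + 10) + 8) + 4 * N + 17)"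

lemma writes_choose_prog [simp]:
  "writes choose_prog = {4, 5, 6, 7, 8, 9, 10, 11, 12, 14, 15, 16, 17, 18, 19, 20, 21}"
  by (auto simp: choose_prog_def)

lemma wp_choose_prog:
  assumes s: "s 4 = enc_candidates C" "s 2 = enc_list enc_candidates R"
    and N: "length C \<le> N" "length R \<le> N" "\<And>v. v \<in> set R \<Longrightarrow> length v \<le> N"
      "\<And>v x. v \<in> set R \<Longrightarrow> x \<in> set v \<Longrightarrow> length x \<le> N"
    and "C \<noteq> []"
  shows "wp choose_prog (\<lambda>t s'. t \<le> choose_time N \<and> (\<exists>c\<in>set C. s' 10 = enc_cand c \<and>
    s' 9 = enc_list enc_candidates (rev (filter (\<lambda>v. c \<notin> set v) R)) \<and>
    (\<forall>c'\<in>set C. length (filter (\<lambda>v. c \<notin> set v) R) \<le> length (filter (\<lambda>v. c' \<notin> set v) R)))) s"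
proof -
  let ?F = "\<lambda>c. filter (\<lambda>v. c \<notin> set v) R"
  \<comment> \<open>\<open>ds\<close> are the candidates already tested and \<open>B\<close> is the
    best list so far. Before the first test only the length of \<open>B\<close> matters: it exceeds
    that of every filtered list.\<close>
  define Inv where "Inv = (\<lambda>cs (s :: store). \<exists>ds B. C = ds @ cs \<and> s 4 = enc_candidates cs \<and>
    s 2 = enc_list enc_candidates R \<and> s 9 = enc_list enc_candidates B \<and>
    length B \<le> N + 1 \<and> (\<forall>d\<in>set ds. length B \<le> length (?F d)) \<and>
    (if ds = [] then length B = length R + 1
     else \<exists>c\<in>set ds. s 10 = enc_cand c \<and> B = rev (?F c)))"
  show ?thesis
    unfolding choose_prog_def wp_Seq[of "SetLeaf _"] wp_Seq[of "SetNode _ _ _"] wp_SetLeaf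
      wp_SetNode
  proof (rule wp_mono[OF wp_While[where Inv = Inv and xs = C
        and T = "N * (N * (10 * N + 10) + 8) + 4 * N + 16"]], goal_cases)
    case 1
    \<comment> \<open>The ballot list with one dummy entry in front, so that the first candidate improves on it.\<close>
    show ?case
      using s N by (auto simp: Inv_def enc_candidates_def intro!: exI[of _ "[] # R"])
  next
    case (2 ys s)
    then show ?case
      by (auto simp: Inv_def enc_candidates_def)
  next
    case (3 c cs s)
    then obtain ds B where s: "C = ds @ c # cs" "s 4 = Node (enc_cand c) (enc_candidates cs)"
      "s 2 = enc_list enc_candidates R" "s 9 = enc_list enc_candidates B"
      "length B \<le> N + 1" "\<And>d. d \<in> set ds \<Longrightarrow> length B \<le> length (?F d)"
      "if ds = [] then length B = length R + 1
       else \<exists>c\<in>set ds. s 10 = enc_cand c \<and> B = rev (?F c)"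
      by (auto simp: Inv_def enc_candidates_def)
    show ?case
      unfolding wp_Seq wp_SetLeft wp_SetRight
    proof (rule wp_call[OF wp_filter_prog[of _ c R N]], goal_cases)
      case (6 t1 s1)
      then have s1: "s1 9 = enc_list enc_candidates B" "s1 5 = enc_cand c"
        "s1 4 = enc_candidates cs" "s1 2 = enc_list enc_candidates R" "s1 10 = s 10"
        using s by auto
      show ?case
      proof (rule wp_call[OF wp_longer_prog[of _ enc_candidates B "rev (?F c)" N]], goal_cases)
        case (4 t2 s2)
        then have s2: "s2 9 = enc_list enc_candidates B" "s2 5 = enc_cand c"
          "s2 4 = enc_candidates cs" "s2 2 = enc_list enc_candidates R" "s2 10 = s 10"
          "s2 8 = enc_list enc_candidates (rev (?F c))"
          using s1 6 by auto
        have B: "ds = [] \<Longrightarrow> length B > length (?F c)"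
          using s(7) by (auto simp: less_Suc_eq_le)
        have F: "length (?F c) \<le> N"
          using N(2) length_filter_le order_trans by blast
        show ?case
        proof (cases "length B > length (?F c)")
          case True
          then have "\<forall>d\<in>set ds. length (?F c) \<le> length (?F d)"
            using s(6) by fastforce
          then have "Inv cs (s2(9 := s2 8, 10 := s2 5))"
            using s(1) s2 F
            by (auto simp: Inv_def intro!: exI[of _ "ds @ [c]"] exI[of _ "rev (?F c)"])
          with True 4 6 show ?thesis
            by simp
        next
          case False
          \<comment> \<open>A candidate that brings no improvement cannot be the first one tested,
            so \<open>B\<close> belongs to an earlier candidate.\<close>
          then have "ds \<noteq> []"
            using B by auto
          then have "Inv cs s2"
            using s(1,5,6,7) s2 False
            by (auto simp: Inv_def intro!: exI[of _ "ds @ [c]"] exI[of _ B])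
          with False 4 6 show ?thesis
            by simp
        qed
      qed (use s1 s(5) 6 in auto)
    qed (use s N in auto)
  next
    case (4 t s')
    moreover from this have "t \<le> 1 + N * (N * (N * (10 * N + 10) + 8) + 4 * N + 17)"
      using mult_le_mono1[OF N(1), of "N * (N * (10 * N + 10) + 8) + 4 * N + 17"]
      by (simp add: algebra_simps)
    ultimately show ?case
      using \<open>C \<noteq> []\<close> by (fastforce simp: Inv_def choose_time_def)
  qed
qed

section \<open>Filling all offices\<close>

definition greedy_prog :: com where
  "greedy_prog = Seq (SetLeft 1 0) (Seq (SetRight 2 0) (Seq (SetLeaf 3) (Seq
     (While 1 (Seq (SetLeft 4 1) (Seq (SetRight 1 1) (Seq choose_prog
        (Seq (Copy 2 9) (SetNode 3 10 3))))))
     (Copy 0 3))))"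

definition greedy_time :: "nat \<Rightarrow> nat" where
  "greedy_time N = 5 + N * (choose_time N + 5)"

text \<open>Turns the list lengths compared by the program into the voter counts of
  \<open>greedy_choice\<close>. Both count identical ballots separately; \<open>Suc\<close> shifts
  list positions to voter numbers.\<close>

lemma card_unrepresented_nth_set:
  "card (unrepresented (length vs) (nth_set vs) X) = length (filter (\<lambda>v. set v \<inter> X = {}) vs)"
proof -
  have "unrepresented (length vs) (nth_set vs) X =
      Suc ` {i. i < length vs \<and> set (vs ! i) \<inter> X = {}}"
    by (force simp: unrepresented_def nth_set_def image_iff gr0_conv_Suc Suc_le_eq)
  then show ?thesis
    by (simp add: card_image length_filter_conv_card)
qed

text \<open>With the next lemma, this lets the size of the encoded instance serve as the single
  bound \<open>N\<close> on all list lengths.\<close>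

lemma length_le_size_enc_list: "length xs \<le> size (enc_list e xs)"
  by (induction xs) auto

lemma size_le_size_enc_list: "x \<in> set xs \<Longrightarrow> size (e x) \<le> size (enc_list e xs)"
  by (induction xs) auto

text \<open>Nonempty offices guarantee that each run of \<open>choose_prog\<close> finds a
  candidate. Winners are pushed onto register 3, so the answer runs from the last office back to the
  first.\<close>

lemma wp_greedy_prog:
  assumes s: "s 0 = enc_instance (As, vs)"
    and N: "length As \<le> N" "length vs \<le> N" "\<And>v. v \<in> set As \<union> set vs \<Longrightarrow> length v \<le> N"
      "\<And>v x. v \<in> set vs \<Longrightarrow> x \<in> set v \<Longrightarrow> length x \<le> N"
    and nonempty: "[] \<notin> set As"
  shows "wp greedy_prog (\<lambda>t s'. t \<le> greedy_time N \<and>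
    (\<exists>w. s' 0 = enc_candidates (rev (map w [1..<Suc (length As)])) \<and>
      (\<forall>j\<in>{1..length As}. greedy_choice (nth_set As) (length vs) (nth_set vs) w j))) s"
proof -
  \<comment> \<open>\<open>Ds\<close> are the offices filled so far. The order of \<open>R\<close>
    is left open because each filtering reverses it.\<close>
  define Inv where "Inv = (\<lambda>Cs (s :: store). \<exists>Ds R w. As = Ds @ Cs \<and>
    s 1 = enc_list enc_candidates Cs \<and> s 2 = enc_list enc_candidates R \<and>
    s 3 = enc_candidates (rev (map w [1..<Suc (length Ds)])) \<and>
    mset R = mset (filter (\<lambda>v. set v \<inter> w ` {1..length Ds} = {}) vs) \<and>
    (\<forall>j\<in>{1..length Ds}. greedy_choice (nth_set As) (length vs) (nth_set vs) w j))"
  show ?thesis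
    unfolding greedy_prog_def wp_Seq[of "SetLeft _ _"] wp_Seq[of "SetRight _ _"]
      wp_Seq[of "SetLeaf _"] wp_Seq[of "While _ _"] wp_SetLeaf wp_SetLeft wp_SetRight
  proof (rule wp_mono[OF wp_While[where Inv = Inv and xs = As
        and T = "choose_time N + 4"]], goal_cases)
    case 1
    show ?case
      using s by (auto simp: Inv_def enc_candidates_def enc_instance_def intro!: exI[of _ vs])
  next
    case (2 ys s)
    then show ?case
      by (auto simp: Inv_def)
  next
    case (3 C Cs s)
    then obtain Ds R w where s: "As = Ds @ C # Cs"
      "s 1 = Node (enc_candidates C) (enc_list enc_candidates Cs)"
      "s 2 = enc_list enc_candidates R"
      "s 3 = enc_candidates (rev (map w [1..<Suc (length Ds)]))"
      "mset R = mset (filter (\<lambda>v. set v \<inter> w ` {1..length Ds} = {}) vs)"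
      and w: "\<forall>j\<in>{1..length Ds}. greedy_choice (nth_set As) (length vs) (nth_set vs) w j"
      unfolding Inv_def enc_list.simps by blast
    let ?W = "w ` {1..length Ds}"
    have R: "set R \<subseteq> set vs"
      using arg_cong[OF s(5), of set_mset] by auto
    have "length R \<le> length vs"
      using mset_eq_length[OF s(5)] length_filter_le by metis
    have C: "nth_set As (Suc (length Ds)) = set C"
      by (simp add: s(1) nth_set_def)
    \<comment> \<open>Ballots disjoint from the old winners that also avoid \<open>c\<close> are
      those disjoint from the enlarged winner set.\<close>
    have filter_R: "mset (filter (\<lambda>v. c \<notin> set v) R) =
        mset (filter (\<lambda>v. set v \<inter> insert c ?W = {}) vs)" for c
    proof -
      have "mset (filter (\<lambda>v. c \<notin> set v) R) =
          filter_mset (\<lambda>v. c \<notin> set v) (mset (filter (\<lambda>v. set v \<inter> ?W = {}) vs))"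
        by (simp only: mset_filter s(5))
      also have "\<dots> = mset (filter (\<lambda>v. set v \<inter> insert c ?W = {}) vs)"
        by (simp add: filter_filter_mset) (rule filter_mset_cong; auto)
      finally show ?thesis .
    qed
    \<comment> \<open>Hence a shortest filtered list is exactly a least count in the sense of
      \<open>greedy_choice\<close>.\<close>
    have card_R: "length (filter (\<lambda>v. c \<notin> set v) R) =
        card (unrepresented (length vs) (nth_set vs) (insert c ?W))" for c
      unfolding card_unrepresented_nth_set by (rule mset_eq_length[OF filter_R])
    show ?case
      unfolding wp_Seq wp_SetLeft wp_SetRight
    proof (rule wp_call[OF wp_choose_prog[of _ C R N]], goal_cases)
      case (8 t s')
      then obtain c where c: "c \<in> set C" "s' 10 = enc_cand c"
        "s' 9 = enc_list enc_candidates (rev (filter (\<lambda>v. c \<notin> set v) R))"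
        "\<And>c'. c' \<in> set C \<Longrightarrow>
          length (filter (\<lambda>v. c \<notin> set v) R) \<le> length (filter (\<lambda>v. c' \<notin> set v) R)"
        by blast
      let ?w = "w(Suc (length Ds) := c)"
      have greedy: "\<forall>j\<in>{1..Suc (length Ds)}.
          greedy_choice (nth_set As) (length vs) (nth_set vs) ?w j"
        using c(1,4) by (intro greedy_choice_extend[OF w]) (simp_all add: C card_R)
      have old: "map ?w [1..<Suc (length Ds)] = map w [1..<Suc (length Ds)]"
        by (rule map_cong) auto
      have new: "?w ` {1..Suc (length Ds)} = insert c ?W"
      proof -
        have "?w ` {1..length Ds} = ?W"
          by (rule image_cong) auto
        moreover have "{1..Suc (length Ds)} = insert (Suc (length Ds)) {1..length Ds}"
          by auto
        ultimately show ?thesis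
          by (metis image_insert fun_upd_same)
      qed
      have "s' 1 = enc_list enc_candidates Cs"
        "s' 3 = enc_candidates (rev (map w [1..<Suc (length Ds)]))"
        using 8 s by auto
      then have "Inv Cs (s'(2 := s' 9, 3 := Node (s' 10) (s' 3)))"
        unfolding Inv_def
        using s(1) c(2,3) greedy new filter_R[of c] old
        by (intro exI[of _ "Ds @ [C]"] exI[of _ "rev (filter (\<lambda>v. c \<notin> set v) R)"] exI[of _ ?w])
          (simp add: enc_candidates_def)
      then show ?case
        using 8 by simp
    qed (use s N R \<open>length R \<le> length vs\<close> nonempty in auto)
  next
    case (4 t s')
    then obtain w where "s' 3 = enc_candidates (rev (map w [1..<Suc (length As)]))"
      "\<forall>j\<in>{1..length As}. greedy_choice (nth_set As) (length vs) (nth_set vs) w j"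
      by (auto simp: Inv_def simp del: upt_Suc)
    moreover have "t \<le> 1 + N * (choose_time N + 5)"
      using 4 mult_le_mono1[OF N(1), of "choose_time N + 5"] by (simp add: algebra_simps)
    ultimately show ?case
      by (auto simp: greedy_time_def simp del: upt_Suc)
  qed
qed

section \<open>Polynomial running time and correctness of the answer\<close>

lemma greedy_time_poly: "\<exists>p :: nat poly. \<forall>N. poly p N = greedy_time N"
proof -
  let ?X = "[:0, 1:] :: nat poly"
  have poly_X: "poly ?X N = N" for N
    by simp
  \<comment> \<open>The time bound is built from sums, products and numerals only, so the same
    expression in the indeterminate is the required polynomial.\<close>
  have "poly (5 + ?X * (3 + ?X * (?X * (?X * (10 * ?X + 10) + 8) + 4 * ?X + 17) + 5)) N =
      greedy_time N" for N
    by (simp only: poly_add poly_mult poly_numeral poly_X greedy_time_def choose_time_def)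
  then show ?thesis
    by blast
qed

text \<open>The output has no repetitions because winners of different offices lie in disjoint
  candidate sets.\<close>

lemma greedy_choice_answer:
  assumes "election (length As) (nth_set As) (length vs) (nth_set vs)"
    and greedy: "\<forall>j\<in>{1..length As}. greedy_choice (nth_set As) (length vs) (nth_set vs) w j"
  shows "global_JR_answer (As, vs) (rev (map w [1..<Suc (length As)]))"
proof -
  have in_office: "w j \<in> nth_set As j" if "j \<in> {1..length As}" for j
    using greedy that by (auto simp: greedy_choice_def)
  have "inj_on w {1..length As}"
  proof (rule inj_onI, rule ccontr)
    fix i j
    assume ij: "i \<in> {1..length As}" "j \<in> {1..length As}" "w i = w j" "i \<noteq> j"
    have "disjoint_family_on (nth_set As) {1..length As}"
      using assms(1) unfolding election_def by blast
    then have "nth_set As i \<inter> nth_set As j = {}"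
      using ij by (intro disjoint_family_onD)
    then show False
      using ij in_office[of i] in_office[of j] by auto
  qed
  moreover have set: "set [1..<Suc (length As)] = {1..length As}"
    by auto
  moreover have "office_allocation (length As) (nth_set As) (w ` {1..length As})"
    unfolding office_allocation_def using in_office by blast
  moreover have "global_JR (length As) (nth_set As) (length vs) (nth_set vs) (w ` {1..length As})"
    using assms(1) greedy by (intro greedy_choice_global_JR) (auto simp: election_def)
  ultimately show ?thesis
    unfolding global_JR_answer_def prod.case set_rev set_map set distinct_rev distinct_map by simp
qed

lemma poly_time_global_JR:
  "poly_time_solvable instances enc_instance enc_candidates global_JR_answer"
proof -
  obtain p :: "nat poly" where p: "\<And>N. poly p N = greedy_time N"
    using greedy_time_poly by blast
  have "\<exists>t s y. exec greedy_prog (initial (enc_instance x)) t s \<and>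
      t \<le> poly p (size (enc_instance x)) \<and> s 0 = enc_candidates y \<and> global_JR_answer x y"
    if "x \<in> instances" for x
  proof -
    obtain As vs where x: "x = (As, vs)"
      by fastforce
    have election: "election (length As) (nth_set As) (length vs) (nth_set vs)"
      using that x by (auto simp: instances_def)
    let ?N = "size (enc_instance (As, vs))"
    have size: "?N = Suc (size (enc_list enc_candidates As) + size (enc_list enc_candidates vs))"
      by (simp add: enc_instance_def)
    have len: "length v \<le> ?N" if "v \<in> set As \<union> set vs" for v
      using that size_le_size_enc_list[of v As enc_candidates]
        size_le_size_enc_list[of v vs enc_candidates] length_le_size_enc_list[of v enc_cand]
      unfolding size enc_candidates_def by force
    have len': "length c \<le> ?N" if "v \<in> set vs" "c \<in> set v" for v c
      using size_le_size_enc_list[OF that(1), of enc_candidates]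
        size_le_size_enc_list[OF that(2), of enc_cand] length_le_size_enc_list[of c enc_bool]
      unfolding size enc_candidates_def by linarith
    have "[] \<notin> set As"
    proof
      assume "[] \<in> set As"
      then obtain j where "j < length As" "As ! j = []"
        by (auto simp: in_set_conv_nth)
      then have "Suc j \<in> {1..length As}" "nth_set As (Suc j) = {}"
        by (auto simp: nth_set_def)
      with election show False
        by (auto simp: election_def)
    qed
    then have "wp greedy_prog (\<lambda>t s'. t \<le> greedy_time ?N \<and>
      (\<exists>w. s' 0 = enc_candidates (rev (map w [1..<Suc (length As)])) \<and>
        (\<forall>j\<in>{1..length As}. greedy_choice (nth_set As) (length vs) (nth_set vs) w j)))
      (initial (enc_instance x))"
      using len len' length_le_size_enc_list[of As enc_candidates]
        length_le_size_enc_list[of vs enc_candidates]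
      by (intro wp_greedy_prog) (auto simp: initial_def x size)
    then show ?thesis
      unfolding wp_def p using greedy_choice_answer[OF election] x by blast
  qed
  then show ?thesis
    unfolding poly_time_solvable_def by blast
qed

theorem proposition1:
  shows "(\<forall>k (A :: nat \<Rightarrow> 'a set) n v. election k A n v \<longrightarrow>
            (\<exists>X. office_allocation k A X \<and> global_JR k A n v X)) \<and>
         poly_time_solvable instances enc_instance enc_candidates global_JR_answer"
proof (intro conjI allI impI poly_time_global_JR)
  \<comment> \<open>Candidates have an arbitrary type here, whereas the program names them by bit
    strings, so existence is derived directly from the greedy choices.\<close>
  fix k n and A v :: "nat \<Rightarrow> 'a set"
  assume election: "election k A n v"
  then obtain w where w: "\<forall>j\<in>{1..k}. greedy_choice A n v w j"
    using greedy_choice_exists[of k A n v] by (auto simp: election_def)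
  then have "office_allocation k A (w ` {1..k})"
    by (auto simp: office_allocation_def greedy_choice_def)
  moreover have "global_JR k A n v (w ` {1..k})"
    using election w by (intro greedy_choice_global_JR) (auto simp: election_def)
  ultimately show "\<exists>X. office_allocation k A X \<and> global_JR k A n v X"
    by blast
qed

end
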